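(* Let $n\ge 2$, $m,l\ge 2$ be integers, let $\Lambda=(\mathcal A^{(1)},\ldots,\mathcal A^{(m-1)})\in\mathcal F_{m,n}$, $\Theta=(\mathcal B^{(1)},\ldots,\mathcal B^{(l-1)})\in\mathcal F_{l,n}$, and let $K\subset\mathbb R^n$ be a closed convex cone. Suppose that $(\mathcal A^{(1)},\mathcal B^{(1)})$ is an $\mathbf{ER}^K$-tensor pair. Suppose moreover that either (i) $m=l$, or (ii) $m\neq l$ and the one of $\mathcal A^{(1)}$ (of order $m$) and $\mathcal B^{(1)}$ (of order $l$) whose order is larger has even order and is positive definite. Then for any given vectors $\boldsymbol a,\boldsymbol b\in\mathbb R^n$, the set $\mathrm{SOL}(\Lambda,\boldsymbol a,\Theta,\boldsymbol b,K)$ is nonempty and compact.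
   Context: $\mathbb T_{m,n}$ is the space of real $m$-th order $n$-dimensional square tensors $\mathcal A=(a_{j_1\ldots j_m})$, $1\le j_1,\ldots,j_m\le n$, and $\mathcal F_{m,n}:=\mathbb T_{m,n}\times\mathbb T_{m-1,n}\times\cdots\times\mathbb T_{2,n}$, so that $\mathcal A^{(k)}\in\mathbb T_{m-k+1,n}$ (similarly $\mathcal B^{(p)}\in\mathbb T_{l-p+1,n}$). For $\mathcal A\in\mathbb T_{m,n}$ and $\boldsymbol x\in\mathbb R^n$, $\mathcal A\boldsymbol x^{m-1}\in\mathbb R^n$ is the vector with $j$-th component $\sum_{j_2,\ldots,j_m=1}^n a_{jj_2\ldots j_m}x_{j_2}\cdots x_{j_m}$, and $\mathcal A\boldsymbol x^m:=\langle\boldsymbol x,\mathcal A\boldsymbol x^{m-1}\rangle$. A tensor $\mathcal A\in\mathbb T_{m,n}$ of even order $m$ is positive definite if $\mathcal A\boldsymbol x^m>0$ for all $\boldsymbol x\in\mathbb R^n\setminus\{\boldsymbol 0\}$. For a closed convex cone $K$, its dual cone is $K^*:=\{\boldsymbol y\in\mathbb R^n\mid\langle\boldsymbol y,\boldsymbol x\rangle\ge0\ \forall\boldsymbol x\in K\}$. $\mathrm{SOL}(\Lambda,\boldsymbol a,\Theta,\boldsymbol b,K)$ is the solution set of the generalized polynomial complementarity problem: the set of all $\boldsymbol x\in\mathbb R^n$ with $F(\boldsymbol x)\in K$, $G(\boldsymbol x)\in K^*$, $\langle F(\boldsymbol x),G(\boldsymbol x)\rangle=0$, where $F(\boldsymbol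 x):=\sum_{k=1}^{m-1}\mathcal A^{(k)}\boldsymbol x^{m-k}+\boldsymbol a$ and $G(\boldsymbol x):=\sum_{p=1}^{l-1}\mathcal B^{(p)}\boldsymbol x^{l-p}+\boldsymbol b$. A pair $(\mathcal A,\mathcal B)\in\mathbb T_{m,n}\times\mathbb T_{l,n}$ is an $\mathbf{ER}^K$-tensor pair if there exists no $(\boldsymbol x,v,t)\in(\mathbb R^n\setminus\{\boldsymbol 0\})\times\mathbb R_+\times\mathbb R_+$ such that $\mathcal A\boldsymbol x^{m-1}+v\boldsymbol x\in K$, $\mathcal B\boldsymbol x^{l-1}+t\boldsymbol x\in K^*$ and $\langle\mathcal A\boldsymbol x^{m-1}+v\boldsymbol x,\mathcal B\boldsymbol x^{l-1}+t\boldsymbol x\rangle=0$. *)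

theory Defs
  imports "HOL-Analysis.Analysis"
begin

text \<open>
  The dimension n is \<open>CARD('n)\<close>. A tensor of order m is a real function on the index
  lists [j_1, ..., j_m] of length m over \<open>'n\<close>; lists are used as indices because tensors
  of different orders occur together in one tuple.
\<close>

type_synonym 'n tensor = "'n list \<Rightarrow> real"

definition tensors :: "nat \<Rightarrow> 'n tensor set" where
  "tensors m = {js. length js = m} \<rightarrow>\<^sub>E UNIV"

text \<open>Tuples (A^(1), ..., A^(m-1)), where the k-th entry has order m - k + 1.\<close>

definition tensor_tuples :: "nat \<Rightarrow> (nat \<Rightarrow> 'n tensor) set" where
  "tensor_tuples m = (\<Pi>\<^sub>E k\<in>{1..m-1}. tensors (m - k + 1))"

text \<open>
  \<open>tensor_apply m A x\<close> is the vector A x^(m-1) for A of order m; the order is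
  an explicit argument since it is not recorded in the type of A.
\<close>

definition tensor_apply :: "nat \<Rightarrow> 'n::finite tensor \<Rightarrow> real ^ 'n \<Rightarrow> real ^ 'n" where
  "tensor_apply m A x =
     (\<chi> j. \<Sum>js\<in>{js. length js = m - 1}. A (j # js) * (\<Prod>i\<leftarrow>js. x $ i))"

definition tensor_form :: "nat \<Rightarrow> 'n::finite tensor \<Rightarrow> real ^ 'n \<Rightarrow> real" where
  "tensor_form m A x = x \<bullet> tensor_apply m A x"

definition positive_definite_tensor :: "nat \<Rightarrow> 'n::finite tensor \<Rightarrow> bool" where
  "positive_definite_tensor m A \<longleftrightarrow> even m \<and> (\<forall>x. x \<noteq> 0 \<longrightarrow> tensor_form m A x > 0)"

definition dual_cone :: "'a::real_inner set \<Rightarrow> 'a set" where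
  "dual_cone K = {y. \<forall>x\<in>K. y \<bullet> x \<ge> 0}"

text \<open>\<open>cone {}\<close> holds in the library, so nonemptiness has to be required separately.\<close>

definition closed_convex_cone :: "'a::real_inner set \<Rightarrow> bool" where
  "closed_convex_cone K \<longleftrightarrow> K \<noteq> {} \<and> closed K \<and> convex K \<and> cone K"

definition tensor_poly ::
    "nat \<Rightarrow> (nat \<Rightarrow> 'n::finite tensor) \<Rightarrow> real ^ 'n \<Rightarrow> real ^ 'n \<Rightarrow> real ^ 'n" where
  "tensor_poly m \<Lambda> a x = (\<Sum>k=1..m-1. tensor_apply (m - k + 1) (\<Lambda> k) x) + a"

definition SOL ::
    "nat \<Rightarrow> nat \<Rightarrow> (nat \<Rightarrow> 'n::finite tensor) \<Rightarrow> real ^ 'n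
      \<Rightarrow> (nat \<Rightarrow> 'n tensor) \<Rightarrow> real ^ 'n \<Rightarrow> (real ^ 'n) set \<Rightarrow> (real ^ 'n) set" where
  "SOL m l \<Lambda> a \<Theta> b K =
     {x. tensor_poly m \<Lambda> a x \<in> K \<and> tensor_poly l \<Theta> b x \<in> dual_cone K \<and>
         tensor_poly m \<Lambda> a x \<bullet> tensor_poly l \<Theta> b x = 0}"

definition ER_tensor_pair ::
    "nat \<Rightarrow> nat \<Rightarrow> (real ^ 'n) set \<Rightarrow> 'n::finite tensor \<Rightarrow> 'n tensor \<Rightarrow> bool" where
  "ER_tensor_pair m l K A B \<longleftrightarrow>
     \<not> (\<exists>x v t. x \<noteq> 0 \<and> v \<ge> 0 \<and> t \<ge> 0 \<and>
         tensor_apply m A x + v *\<^sub>R x \<in> K \<and>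
         tensor_apply l B x + t *\<^sub>R x \<in> dual_cone K \<and>
         (tensor_apply m A x + v *\<^sub>R x) \<bullet> (tensor_apply l B x + t *\<^sub>R x) = 0)"

end

theory Submission
  imports Defs
begin

text \<open>
  For \<open>t \<in> [0,1]\<close> consider the complementarity problem for the pair
  \<open>(1-t) F + t id\<close>, \<open>(1-t) G + t id\<close>. Normalising an unbounded sequence of solutions and
  passing to the limit contradicts the ER property or positive definiteness, so all solutions,
  for all \<open>t\<close>, lie in one ball of radius \<open>R\<close>; for \<open>t = 0\<close> this gives compactness. The solutions
  at parameter \<open>t\<close> are the fixed points of
  \<open>\<Phi>\<^sub>t(x) = (1-t)(x - F x) + P\<^sub>K((1-t)(F x - G x))\<close>. Letting \<open>t\<close> grow from 0 to 1 with the norm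
  of \<open>x\<close> between \<open>R\<close> and \<open>R+1\<close> yields a bounded continuous map, and its Brouwer fixed point
  lies in the ball of radius \<open>R\<close>, where \<open>t = 0\<close>.
\<close>

section \<open>Homogeneity, continuity and leading-term asymptotics of tensor maps\<close>

lemma tensor_apply_scaleR: "tensor_apply k A (r *\<^sub>R x) = r ^ (k - 1) *\<^sub>R tensor_apply k A x"
proof -
  have prod: "(\<Prod>i\<leftarrow>js. r * x $ i) = r ^ length js * (\<Prod>i\<leftarrow>js. x $ i)" for js
    by (induction js) auto
  show ?thesis
    by (auto simp: tensor_apply_def vec_eq_iff prod sum_distrib_left intro!: sum.cong)
qed

lemma continuous_on_tensor_apply [continuous_intros]:
  fixes A :: "'n::finite tensor"
  shows "continuous_on S (tensor_apply k A)"
proof -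
  have "continuous_on S (\<lambda>x. \<Prod>i\<leftarrow>js. x $ i)" for js :: "'n list"
    by (induction js) (auto intro!: continuous_intros)
  then show ?thesis
    unfolding tensor_apply_def by (intro continuous_intros)
qed

lemma continuous_on_tensor_poly: "continuous_on S (tensor_poly m \<Lambda> a)"
  unfolding tensor_poly_def by (intro continuous_intros)

text \<open>The \<open>k\<close>-th summand has degree \<open>m - k\<close>, so division by
  \<open>r i ^ (m - 1)\<close> leaves it a factor \<open>r i\<close> to the power
  \<open>-(k - 1)\<close>, which vanishes in the limit unless \<open>k = 1\<close>; the constant
  \<open>a\<close> vanishes likewise.\<close>

lemma tendsto_tensor_poly_div_power:
  fixes a :: "real ^ 'n::finite"
  assumes m: "m \<ge> 2" and y: "y \<longlonglongrightarrow> z" and r: "filterlim r at_top sequentially"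
  shows "(\<lambda>i. tensor_poly m \<Lambda> a (r i *\<^sub>R y i) /\<^sub>R r i ^ (m - 1)) \<longlonglongrightarrow> tensor_apply m (\<Lambda> 1) z"
proof -
  have lim: "(\<lambda>i. tensor_apply k A (y i)) \<longlonglongrightarrow> tensor_apply k A z" for k A
    using continuous_on_tensor_apply[of UNIV k A] y
    by (auto simp: continuous_on_eq_continuous_at intro: isCont_tendsto_compose)
  have pow: "(\<lambda>i. inverse (r i) ^ k) \<longlonglongrightarrow> 0" if "k > 0" for k
    using tendsto_power[OF tendsto_inverse_0_at_top[OF r], of k] that by (simp add: power_0_left)
  have ev: "eventually (\<lambda>i. r i > 0) sequentially"
    using r by (simp add: filterlim_at_top_dense)
  have split: "(\<Sum>k=1..m-1. f k) = f 1 + (\<Sum>k=2..m-1. f k)" for f :: "nat \<Rightarrow> real ^ 'n"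
    using m sum.atLeast_Suc_atMost[of 1 "m - 1" f] by (simp add: numeral_2_eq_2)
  have "(\<lambda>i. tensor_apply m (\<Lambda> 1) (y i)
          + (\<Sum>k=2..m-1. inverse (r i) ^ (k - 1) *\<^sub>R tensor_apply (m - k + 1) (\<Lambda> k) (y i))
          + inverse (r i) ^ (m - 1) *\<^sub>R a)
        \<longlonglongrightarrow> tensor_apply m (\<Lambda> 1) z
          + (\<Sum>k=2..m-1. 0 *\<^sub>R tensor_apply (m - k + 1) (\<Lambda> k) z) + 0 *\<^sub>R a"
    using m by (intro tendsto_intros lim pow) auto
  moreover have "eventually (\<lambda>i. tensor_apply m (\<Lambda> 1) (y i)
          + (\<Sum>k=2..m-1. inverse (r i) ^ (k - 1) *\<^sub>R tensor_apply (m - k + 1) (\<Lambda> k) (y i))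
          + inverse (r i) ^ (m - 1) *\<^sub>R a
        = tensor_poly m \<Lambda> a (r i *\<^sub>R y i) /\<^sub>R r i ^ (m - 1)) sequentially"
    using ev
  proof eventually_elim
    case (elim i)
    have "r i ^ (m - k) / r i ^ (m - 1) = inverse (r i) ^ (k - 1)" if "k \<in> {2..m-1}" for k
    proof -
      have "m - 1 = (m - k) + (k - 1)" using that by auto
      then have "r i ^ (m - 1) = r i ^ (m - k) * r i ^ (k - 1)" by (metis power_add)
      then show ?thesis using elim by (simp add: field_simps)
    qed
    then have "(\<Sum>k=2..m-1. inverse (r i) ^ (k - 1) *\<^sub>R tensor_apply (m - k + 1) (\<Lambda> k) (y i))
      = (\<Sum>k=2..m-1. tensor_apply (m - k + 1) (\<Lambda> k) (r i *\<^sub>R y i)) /\<^sub>R r i ^ (m - 1)"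
      by (auto simp: tensor_apply_scaleR scaleR_sum_right divide_inverse_commute intro!: sum.cong)
    \<comment> \<open>The summand \<open>k = 1\<close> has order \<open>m - 1 + 1\<close>, with
      truncated subtraction.\<close>
    moreover have "m - 1 + 1 = m" using m by simp
    ultimately show ?case
      using elim unfolding tensor_poly_def split
      by (simp add: tensor_apply_scaleR scaleR_add_right power_inverse)
  qed
  ultimately show ?thesis
    by (auto intro: Lim_transform_eventually)
qed

section \<open>Complementary pairs for a cone and its dual\<close>

lemma closed_dual_cone: "closed (dual_cone K)"
proof -
  have "dual_cone K = (\<Inter>x\<in>K. {y. y \<bullet> x \<ge> 0})" by (auto simp: dual_cone_def)
  then show ?thesis by (auto intro!: closed_INT closed_Collect_le continuous_intros)
qed

lemma dual_cone_scaleR: "y \<in> dual_cone K \<Longrightarrow> c \<ge> 0 \<Longrightarrow> c *\<^sub>R y \<in> dual_cone K"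
  by (auto simp: dual_cone_def)

definition complementary :: "'a::real_inner set \<Rightarrow> 'a \<Rightarrow> 'a \<Rightarrow> bool" where
  "complementary K u w \<longleftrightarrow> u \<in> K \<and> w \<in> dual_cone K \<and> u \<bullet> w = 0"

text \<open>The two factors are independent, so \<open>F\<close> and \<open>G\<close> can later be
  normalised by different powers of the norm.\<close>

lemma complementary_scaleR:
  assumes "cone K" "complementary K u w" "c \<ge> 0" "d \<ge> 0"
  shows "complementary K (c *\<^sub>R u) (d *\<^sub>R w)"
  using assms by (auto simp: complementary_def dual_cone_scaleR cone_def)

lemma complementary_LIMSEQ:
  assumes "closed K" "u \<longlonglongrightarrow> u'" "w \<longlonglongrightarrow> w'" "\<And>i. complementary K (u i) (w i)"
  shows "complementary K u' w'"
proof -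
  have "(\<lambda>i. u i \<bullet> w i) \<longlonglongrightarrow> u' \<bullet> w'" using assms by (intro tendsto_intros)
  moreover have "(\<lambda>i. u i \<bullet> w i) = (\<lambda>i. 0)" using assms(4) by (auto simp: complementary_def)
  ultimately have "u' \<bullet> w' = 0" using LIMSEQ_unique tendsto_const by metis
  moreover have "u' \<in> K" using assms by (auto simp: complementary_def intro: closed_sequentially)
  moreover have "w' \<in> dual_cone K"
    using assms by (auto simp: complementary_def intro: closed_sequentially[OF closed_dual_cone])
  ultimately show ?thesis by (auto simp: complementary_def)
qed

text \<open>The variational inequality of the projection gives
  \<open>w \<bullet> (y - u) \<ge> 0\<close> on \<open>K\<close>. Testing it with
  \<open>y = 0\<close> and \<open>y = 2 u\<close> yields orthogonality, after which it says that
  \<open>w\<close> lies in the dual cone.\<close>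

lemma complementary_if_closest_point:
  fixes K :: "'a::euclidean_space set"
  assumes K: "closed_convex_cone K" and eq: "u = closest_point K (u - w)"
  shows "complementary K u w"
proof -
  have cK: "closed K" "convex K" "cone K" "K \<noteq> {}" using K by (auto simp: closed_convex_cone_def)
  have u: "u \<in> K" using eq closest_point_in_set cK by metis
  have var: "w \<bullet> (y - u) \<ge> 0" if "y \<in> K" for y
    using closest_point_dot[OF cK(2,1) that, of "u - w"] eq by simp
  have "0 \<in> K" "2 *\<^sub>R u \<in> K" using cK u by (auto simp: cone_def cone_contains_0)
  from var[OF this(1)] var[OF this(2)] have "u \<bullet> w = 0"
    by (simp add: inner_diff_right inner_commute)
  moreover have "w \<bullet> y \<ge> 0" if "y \<in> K" for y
    using var[OF that] \<open>u \<bullet> w = 0\<close> by (simp add: inner_diff_right inner_commute)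
  ultimately show ?thesis using u by (auto simp: complementary_def dual_cone_def)
qed

section \<open>Existence from an a priori bound\<close>

lemma complementary_exists_if_homotopy_bounded:
  fixes F G :: "'a::euclidean_space \<Rightarrow> 'a"
  assumes K: "closed_convex_cone K"
    and F: "continuous_on UNIV F" and G: "continuous_on UNIV G"
    and bnd: "\<And>t x. 0 \<le> t \<Longrightarrow> t \<le> 1 \<Longrightarrow>
      complementary K ((1 - t) *\<^sub>R F x + t *\<^sub>R x) ((1 - t) *\<^sub>R G x + t *\<^sub>R x) \<Longrightarrow> norm x \<le> R"
  obtains x where "complementary K (F x) (G x)"
proof -
  have cK: "closed K" "convex K" "cone K" "K \<noteq> {}" using K by (auto simp: closed_convex_cone_def)
  \<comment> \<open>The homotopy parameter becomes a function of \<open>x\<close>, so that a single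
    application of Brouwer's theorem suffices: it is 0 on the ball of radius \<open>R\<close> and 1
    outside that of radius \<open>R + 1\<close>.\<close>
  define s where "s x = min 1 (max 0 (norm x - R))" for x :: 'a
  define \<Psi> where "\<Psi> x = (1 - s x) *\<^sub>R (x - F x) + closest_point K ((1 - s x) *\<^sub>R (F x - G x))" for x
  have cont: "continuous_on S \<Psi>" for S
    unfolding \<Psi>_def s_def
    by (intro continuous_intros continuous_on_compose2[OF continuous_on_closest_point[OF cK(2,1,4)]]
        continuous_on_subset[OF F] continuous_on_subset[OF G]) auto
  \<comment> \<open>Where \<open>s x = 1\<close>, both terms of \<open>\<Psi> x\<close> vanish
    because the projection fixes 0. Hence \<open>\<Psi>\<close> is bounded on the whole space and
    maps a ball of radius \<open>M\<close>, unrelated to \<open>R\<close>, into itself.\<close>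
  have "0 \<in> K" using cK cone_contains_0 by blast
  then have zero: "\<Psi> x = 0" if "norm x \<ge> R + 1" for x
    using that by (simp add: \<Psi>_def s_def closest_point_self)
  have "bounded (\<Psi> ` cball 0 (R + 1))"
    by (intro compact_imp_bounded compact_continuous_image cont) auto
  then obtain M where M: "M > 0" "\<And>x. norm x \<le> R + 1 \<Longrightarrow> norm (\<Psi> x) \<le> M"
    by (auto simp: bounded_pos)
  have "norm (\<Psi> x) \<le> M" for x
    using M zero[of x] by (cases "norm x \<le> R + 1") auto
  then obtain x where x: "\<Psi> x = x"
    using brouwer_ball[OF M(1) cont, of 0] by (metis image_subsetI Pi_I' mem_cball_0)
  have s: "0 \<le> s x" "s x \<le> 1" by (auto simp: s_def)
  have comp: "complementary K ((1 - s x) *\<^sub>R F x + s x *\<^sub>R x) ((1 - s x) *\<^sub>R G x + s x *\<^sub>R x)"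
  proof (rule complementary_if_closest_point[OF K])
    have eq: "(1 - s x) *\<^sub>R F x + s x *\<^sub>R x = closest_point K ((1 - s x) *\<^sub>R (F x - G x))"
      using x unfolding \<Psi>_def by (simp add: algebra_simps add_eq_0_iff2)
    \<comment> \<open>The terms \<open>s x\<close> times \<open>x\<close> cancel, so the fixed point
      equation has the form \<open>u = closest_point K (u - w)\<close>.\<close>
    have diff: "(1 - s x) *\<^sub>R (F x - G x) = (1 - s x) *\<^sub>R F x + s x *\<^sub>R x
        - ((1 - s x) *\<^sub>R G x + s x *\<^sub>R x)"
      by (simp add: algebra_simps)
    show "(1 - s x) *\<^sub>R F x + s x *\<^sub>R x = closest_point K ((1 - s x) *\<^sub>R F x + s x *\<^sub>R x
        - ((1 - s x) *\<^sub>R G x + s x *\<^sub>R x))"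
      using eq unfolding diff .
  qed
  have "norm x \<le> R" by (rule bnd[OF s comp])
  then have "s x = 0" by (simp add: s_def)
  with comp show ?thesis by (intro that) simp
qed

section \<open>The a priori bound\<close>

text \<open>Excludes nonzero limits of normalised solutions. The weights \<open>p\<close>,
  \<open>q\<close> compactify the multipliers \<open>p / (1 - p)\<close> and
  \<open>q / (1 - q)\<close> of the ER property; weight 1 stands for an infinite multiplier, and
  positive definiteness handles the case where exactly one is infinite.\<close>

lemma ER_tensor_pair_convex_combination:
  assumes K: "closed_convex_cone K" and ER: "ER_tensor_pair m l K A B"
    and dom: "m = l \<or> m > l \<and> positive_definite_tensor m A
      \<or> m < l \<and> positive_definite_tensor l B"
    and p: "0 \<le> p" "p \<le> 1" and q: "0 \<le> q" "q \<le> 1"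
    and pq: "m \<ge> l \<Longrightarrow> p \<le> q" "l \<ge> m \<Longrightarrow> q \<le> p"
    and comp: "complementary K ((1 - p) *\<^sub>R tensor_apply m A y + p *\<^sub>R y)
      ((1 - q) *\<^sub>R tensor_apply l B y + q *\<^sub>R y)"
  shows "y = 0"
proof (rule ccontr)
  assume y: "y \<noteq> 0"
  have cone: "cone K" using K by (simp add: closed_convex_cone_def)
  consider "p < 1" "q < 1" | "p = 1" "q = 1" | "p = 1" "q < 1" | "p < 1" "q = 1"
    using p q by linarith
  then show False
  proof cases
    case 1
    have "complementary K (tensor_apply m A y + (p / (1 - p)) *\<^sub>R y)
      (tensor_apply l B y + (q / (1 - q)) *\<^sub>R y)"
      using complementary_scaleR[OF cone comp, of "1 / (1 - p)" "1 / (1 - q)"] 1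
      by (simp add: scaleR_add_right)
    moreover have "p / (1 - p) \<ge> 0" "q / (1 - q) \<ge> 0" using p q by auto
    ultimately show ?thesis using ER y unfolding ER_tensor_pair_def complementary_def by blast
  next
    case 2
    then show ?thesis using comp y by (simp add: complementary_def)
  next
    case 3
    \<comment> \<open>By \<open>pq\<close>, \<open>q < p\<close> forces \<open>m < l\<close>, so
      \<open>B\<close> is the positive definite tensor. As the first vector is \<open>y\<close>
      itself, orthogonality makes a sum of a positive and a nonnegative term vanish.\<close>
    then have "tensor_form l B y > 0"
      using pq dom y by (auto simp: positive_definite_tensor_def)
    moreover have "(1 - q) * tensor_form l B y + q * (y \<bullet> y) = 0"
      using comp 3 by (simp add: complementary_def tensor_form_def inner_add_right)
    moreover have "q * (y \<bullet> y) \<ge> 0" using q by simp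
    ultimately show ?thesis using 3 mult_pos_pos[of "1 - q" "tensor_form l B y"] by linarith
  next
    case 4
    then have "tensor_form m A y > 0"
      using pq dom y by (auto simp: positive_definite_tensor_def)
    moreover have "(1 - p) * tensor_form m A y + p * (y \<bullet> y) = 0"
      using comp 4 by (simp add: complementary_def tensor_form_def inner_add_right inner_commute)
    moreover have "p * (y \<bullet> y) \<ge> 0" using p by simp
    ultimately show ?thesis using 4 mult_pos_pos[of "1 - p" "tensor_form m A y"] by linarith
  qed
qed

lemma homotopy_complementary_bounded:
  fixes \<Lambda> \<Theta> :: "nat \<Rightarrow> 'n::finite tensor"
  assumes m: "m \<ge> 2" and l: "l \<ge> 2"
    and K: "closed_convex_cone K" and ER: "ER_tensor_pair m l K (\<Lambda> 1) (\<Theta> 1)"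
    and dom: "m = l \<or> m > l \<and> positive_definite_tensor m (\<Lambda> 1)
      \<or> m < l \<and> positive_definite_tensor l (\<Theta> 1)"
  obtains R where "\<And>t x. 0 \<le> t \<Longrightarrow> t \<le> 1 \<Longrightarrow>
      complementary K ((1 - t) *\<^sub>R tensor_poly m \<Lambda> a x + t *\<^sub>R x)
        ((1 - t) *\<^sub>R tensor_poly l \<Theta> b x + t *\<^sub>R x) \<Longrightarrow> norm x \<le> R"
proof (rule ccontr)
  let ?F = "tensor_poly m \<Lambda> a" and ?G = "tensor_poly l \<Theta> b"
  assume "\<not> thesis"
  \<comment> \<open>The bound \<open>real i + 1\<close> makes the norms tend to infinity and also
    keeps them above 1, which the comparison of powers in \<open>p_mono\<close> uses.\<close>
  then have "\<forall>i::nat. \<exists>t x. 0 \<le> t \<and> t \<le> 1 \<and> norm x > real i + 1 \<and>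
      complementary K ((1 - t) *\<^sub>R ?F x + t *\<^sub>R x) ((1 - t) *\<^sub>R ?G x + t *\<^sub>R x)"
    using that by (meson not_le)
  then obtain t x where t: "\<And>i::nat. 0 \<le> t i" "\<And>i. t i \<le> 1"
    and x: "\<And>i. norm (x i) > real i + 1"
    and comp: "\<And>i. complementary K ((1 - t i) *\<^sub>R ?F (x i) + t i *\<^sub>R x i)
      ((1 - t i) *\<^sub>R ?G (x i) + t i *\<^sub>R x i)"
    by metis
  have cK: "closed K" "cone K" using K by (auto simp: closed_convex_cone_def)
  define r where "r i = norm (x i)" for i
  define y where "y i = x i /\<^sub>R r i" for i
  \<comment> \<open>Dividing by \<open>D\<close> rather than by \<open>(1 - t) r^(k-1)\<close> keeps the coefficient of \<open>y\<close> in \<open>[0,1]\<close>,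
    so limits exist even if the multipliers \<open>v\<close>, \<open>t\<close> of the ER property would diverge.\<close>
  define D where "D k i = (1 - t i) * r i ^ (k - 1) + t i * r i" for k i
  define p where "p k i = t i * r i / D k i" for k i
  have r1: "r i > 1" for i using x[of i] by (simp add: r_def)
  have xy: "x i = r i *\<^sub>R y i" for i using r1[of i] by (simp add: y_def)
  have D: "D k i > 0" for k i
  proof (cases "t i = 1")
    case False
    then have "(1 - t i) * r i ^ (k - 1) > 0" "t i * r i \<ge> 0" using t[of i] r1[of i] by auto
    then show ?thesis by (simp add: D_def)
  qed (use r1[of i] in \<open>simp add: D_def\<close>)
  have p: "0 \<le> p k i" "p k i \<le> 1" for k i
    using t[of i] r1[of i] D[of k i] by (auto simp: p_def D_def)
  have q: "1 - p k i = (1 - t i) * r i ^ (k - 1) / D k i" for k i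
    using D[of k i] by (simp add: p_def field_simps) (simp add: D_def algebra_simps)
  \<comment> \<open>A larger order gives a larger normaliser \<open>D\<close>, hence a smaller
    weight. In the limit this becomes the ordering of \<open>p'\<close> and \<open>q'\<close> that
    decides which multiplier can be infinite.\<close>
  have p_mono: "p k i \<le> p j i" if "k \<ge> j" for j k i
  proof -
    have "r i ^ (j - 1) \<le> r i ^ (k - 1)" using r1[of i] that by (intro power_increasing) auto
    then have "D j i \<le> D k i" using t[of i] by (simp add: D_def mult_left_mono)
    then show ?thesis
      unfolding p_def using D t[of i] r1[of i] by (intro divide_left_mono) auto
  qed
  have scale: "((1 - t i) *\<^sub>R u + t i *\<^sub>R x i) /\<^sub>R D k i
      = (1 - p k i) *\<^sub>R (u /\<^sub>R r i ^ (k - 1)) + p k i *\<^sub>R y i" for u k i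
  proof -
    have u: "(1 - p k i) * inverse (r i ^ (k - 1)) = inverse (D k i) * (1 - t i)"
      using r1[of i] by (simp add: q divide_inverse)
    have x: "p k i *\<^sub>R y i = inverse (D k i) *\<^sub>R t i *\<^sub>R x i"
      by (simp add: xy p_def divide_inverse mult_ac)
    show ?thesis unfolding x scaleR_add_right scaleR_scaleR u by (rule refl)
  qed
  have comp': "complementary K
      ((1 - p m i) *\<^sub>R (?F (r i *\<^sub>R y i) /\<^sub>R r i ^ (m - 1)) + p m i *\<^sub>R y i)
      ((1 - p l i) *\<^sub>R (?G (r i *\<^sub>R y i) /\<^sub>R r i ^ (l - 1)) + p l i *\<^sub>R y i)" for i
    using complementary_scaleR[OF cK(2) comp[of i], of "inverse (D m i)" "inverse (D l i)"]
      D[of m i] D[of l i] unfolding scale by (simp flip: xy)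
  \<comment> \<open>Directions and both weights are extracted jointly, so that one subsequence
    \<open>h\<close> serves all three.\<close>
  have "seq_compact (sphere (0::real^'n) 1 \<times> {0..1::real} \<times> {0..1::real})"
    by (intro compact_imp_seq_compact compact_Times) auto
  moreover have "\<forall>i. (y i, p m i, p l i) \<in> sphere 0 1 \<times> {0..1} \<times> {0..1}"
  proof
    fix i
    have "norm (y i) = 1" using r1[of i] by (simp add: y_def flip: r_def)
    then show "(y i, p m i, p l i) \<in> sphere 0 1 \<times> {0..1} \<times> {0..1}" using p by auto
  qed
  ultimately obtain L h where L: "L \<in> sphere (0::real^'n) 1 \<times> {0..1::real} \<times> {0..1::real}"
    and h: "strict_mono h" and lim: "((\<lambda>i. (y i, p m i, p l i)) \<circ> h) \<longlonglongrightarrow> L"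
    by (rule seq_compactE) auto
  obtain z p' q' where L_eq: "L = (z, p', q')" by (metis surj_pair)
  have z: "norm z = 1" and p': "0 \<le> p'" "p' \<le> 1" and q': "0 \<le> q'" "q' \<le> 1"
    using L by (auto simp: L_eq)
  have limy: "(\<lambda>i. y (h i)) \<longlonglongrightarrow> z"
    using tendsto_fst[OF lim] by (simp add: L_eq o_def)
  have limp: "(\<lambda>i. p m (h i)) \<longlonglongrightarrow> p'"
    using tendsto_fst[OF tendsto_snd[OF lim]] by (simp add: L_eq o_def)
  have limq: "(\<lambda>i. p l (h i)) \<longlonglongrightarrow> q'"
    using tendsto_snd[OF tendsto_snd[OF lim]] by (simp add: L_eq o_def)
  have "filterlim r at_top sequentially"
    using x by (intro filterlim_at_top_mono[OF filterlim_real_sequentially])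
      (auto simp: r_def intro!: always_eventually less_imp_le less_trans[OF _ x])
  then have limr: "filterlim (\<lambda>i. r (h i)) at_top sequentially"
    using filterlim_compose filterlim_subseq[OF h] by blast
  have limF: "(\<lambda>i. (1 - p m (h i)) *\<^sub>R (?F (r (h i) *\<^sub>R y (h i)) /\<^sub>R r (h i) ^ (m - 1))
      + p m (h i) *\<^sub>R y (h i)) \<longlonglongrightarrow> (1 - p') *\<^sub>R tensor_apply m (\<Lambda> 1) z + p' *\<^sub>R z"
    by (intro tendsto_intros limp limy tendsto_tensor_poly_div_power m limr)
  have limG: "(\<lambda>i. (1 - p l (h i)) *\<^sub>R (?G (r (h i) *\<^sub>R y (h i)) /\<^sub>R r (h i) ^ (l - 1))
      + p l (h i) *\<^sub>R y (h i)) \<longlonglongrightarrow> (1 - q') *\<^sub>R tensor_apply l (\<Theta> 1) z + q' *\<^sub>R z"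
    by (intro tendsto_intros limq limy tendsto_tensor_poly_div_power l limr)
  have "complementary K ((1 - p') *\<^sub>R tensor_apply m (\<Lambda> 1) z + p' *\<^sub>R z)
      ((1 - q') *\<^sub>R tensor_apply l (\<Theta> 1) z + q' *\<^sub>R z)"
    by (rule complementary_LIMSEQ[OF cK(1) limF limG comp'])
  moreover have "p' \<le> q'" if "m \<ge> l"
    by (rule LIMSEQ_le[OF limp limq]) (simp add: p_mono[OF that])
  moreover have "q' \<le> p'" if "l \<ge> m"
    by (rule LIMSEQ_le[OF limq limp]) (simp add: p_mono[OF that])
  ultimately have "z = 0"
    using ER_tensor_pair_convex_combination[OF K ER dom p' q'] by blast
  with z show False by simp
qed

section \<open>Nonemptiness and compactness of the solution set\<close>

theorem theorem3p1:
  fixes \<Lambda> \<Theta> :: "nat \<Rightarrow> 'n::finite tensor"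
    and K :: "(real ^ 'n) set"
    and a b :: "real ^ 'n"
    and m l :: nat
  assumes "CARD('n) \<ge> 2" and "m \<ge> 2" and "l \<ge> 2"
    and "\<Lambda> \<in> tensor_tuples m" and "\<Theta> \<in> tensor_tuples l"
    and "closed_convex_cone K"
    and "ER_tensor_pair m l K (\<Lambda> 1) (\<Theta> 1)"
    and "m = l \<or>
         (m > l \<and> even m \<and> positive_definite_tensor m (\<Lambda> 1)) \<or>
         (m < l \<and> even l \<and> positive_definite_tensor l (\<Theta> 1))"
  shows "SOL m l \<Lambda> a \<Theta> b K \<noteq> {} \<and> compact (SOL m l \<Lambda> a \<Theta> b K)"
proof -
  let ?F = "tensor_poly m \<Lambda> a" and ?G = "tensor_poly l \<Theta> b"
  have SOL: "SOL m l \<Lambda> a \<Theta> b K = {x. complementary K (?F x) (?G x)}"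
    by (simp add: SOL_def complementary_def)
  have cont: "continuous_on UNIV ?F" "continuous_on UNIV ?G"
    by (rule continuous_on_tensor_poly)+
  have dom: "m = l \<or> m > l \<and> positive_definite_tensor m (\<Lambda> 1)
      \<or> m < l \<and> positive_definite_tensor l (\<Theta> 1)"
    using assms(8) by blast
  obtain R where R: "\<And>t x. 0 \<le> t \<Longrightarrow> t \<le> 1 \<Longrightarrow>
      complementary K ((1 - t) *\<^sub>R ?F x + t *\<^sub>R x) ((1 - t) *\<^sub>R ?G x + t *\<^sub>R x) \<Longrightarrow> norm x \<le> R"
    using homotopy_complementary_bounded[where \<Lambda> = \<Lambda> and \<Theta> = \<Theta>, OF assms(2,3,6,7) dom]
    by metis
  obtain x where "complementary K (?F x) (?G x)"
    by (rule complementary_exists_if_homotopy_bounded[OF assms(6) cont]) (rule R)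
  \<comment> \<open>At parameter 0 the homotopy is the original problem, so \<open>R\<close> also
    bounds all its solutions.\<close>
  moreover have "bounded (SOL m l \<Lambda> a \<Theta> b K)"
    using R[of 0] by (auto simp: SOL bounded_iff)
  \<comment> \<open>Complementarity passes to limits, and \<open>F\<close> and \<open>G\<close> are
    continuous.\<close>
  moreover have "closed (SOL m l \<Lambda> a \<Theta> b K)"
    unfolding closed_sequential_limits
  proof (intro allI impI, elim conjE)
    fix x z assume x: "\<forall>i. x i \<in> SOL m l \<Lambda> a \<Theta> b K" and lim: "x \<longlonglongrightarrow> z"
    have "(\<lambda>i. ?F (x i)) \<longlonglongrightarrow> ?F z" "(\<lambda>i. ?G (x i)) \<longlonglongrightarrow> ?G z"
      using cont lim by (auto simp: continuous_on_eq_continuous_at intro: isCont_tendsto_compose)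
    then show "z \<in> SOL m l \<Lambda> a \<Theta> b K"
      using complementary_LIMSEQ[of K] x assms(6) by (auto simp: SOL closed_convex_cone_def)
  qed
  ultimately show ?thesis by (auto simp: SOL compact_eq_bounded_closed)
qed

end
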